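(* Let $p,q\ge 0$ be integers and $n=p+q\geq 1$. The following subspaces of the real Clifford algebra $\mathcal{C}\!\ell^{\mathbb R}(p,q)$ are closed with respect to the anticommutator $U,V\mapsto\{U,V\}=UV+VU$ and hence form subalgebras of the Clifford algebra considered with respect to this operation: 1) for $n\ge1$: $\widehat{\mathbf 0}$; 2) for $n\ge2$: $\widehat{\mathbf 0}\oplus\widehat{\mathbf 1}$; 3) for $n\ge2$: $\widehat{\mathbf 0}\oplus\widehat{\mathbf n}$; 4) for $n\ge3$: $\widehat{\mathbf 0}\oplus\widehat{\mathbf{n-1}}$; 5) for even $n\ge4$: $\widehat{\mathbf 0}\oplus\widehat{\mathbf 1}\oplus\widehat{\mathbf n}$; 6) for even $n\ge4$: $\widehat{\mathbf 0}\oplus\widehat{\mathbf{n-1}}\oplus\widehat{\mathbf n}$; 7) for $n\ge4$ (if $n=1$ it is the same as item 1, if $n=2$ as item 3, if $n=3$ as item 4): $\widehat{\mathbf 0}\oplus\widehat{\mathbf 2}\oplus\widehat{\mathbf 4}\oplus\widehat{\mathbf 6}\oplus\ldots\oplus\widehat{\mathbf k}=\overline{\mathbf{02}}$ (all even ranks up to the even number $k$), where $n=k,k+1$; 8) for odd $n\ge5$: $\widehat{\mathbf 0}\oplus\widehat{\mathbf 1}\oplus\widehat{\mathbf{n-1}}\oplus\widehat{\mathbf n}$; 9) for $n\ge5$ (if $n=1,2$ it is the same as item 1, if $n=3$ as item 3, if $n=4$ as item 6): $\widehat{\mathbf 0}\oplus\widehat{\mathbf 3}\oplus\widehat{\mathbf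 4}\oplus\widehat{\mathbf 7}\oplus\widehat{\mathbf 8}\oplus\widehat{\mathbf{11}}\oplus\ldots\oplus\widehat{\mathbf k}=\overline{\mathbf{03}}$ (all ranks $\equiv0,3\pmod4$ up to $k$), where $n=k,k+1,k+2$ for even $k$ and $n=k$ for odd $k$; 10) for $n\ge6$ (if $n=2,3$ it is the same as item 2, if $n=4$ as item 5, if $n=5$ as item 8): $\widehat{\mathbf 0}\oplus\widehat{\mathbf 1}\oplus\widehat{\mathbf 4}\oplus\widehat{\mathbf 5}\oplus\widehat{\mathbf 8}\oplus\widehat{\mathbf 9}\oplus\ldots\oplus\widehat{\mathbf k}=\overline{\mathbf{01}}$ (all ranks $\equiv0,1\pmod4$ up to $k$), where $n=k,k+1,k+2$ for odd $k$ and $n=k$ for even $k$; 11) for $n\ge6$ (if $n=1,2,3$ it is the same as item 1, if $n=4$ as item 3, if $n=5$ as item 4): $\widehat{\mathbf 0}\oplus\widehat{\mathbf 4}\oplus\widehat{\mathbf 8}\oplus\widehat{\mathbf{12}}\oplus\ldots\oplus\widehat{\mathbf k}=\overline{\mathbf 0}$ (all ranks $\equiv0\pmod4$ up to $k\equiv 0\pmod 4$), where $n=k,k+1,k+2,k+3$.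
   Context: $\mathcal{C}\!\ell^{\mathbb R}(p,q)$ is the real Clifford algebra with identity $e$ and generators $e^1,\dots,e^n$, $n=p+q$, satisfying $e^ae^b+e^be^a=2\eta^{ab}e$, where $\eta$ is diagonal with $p$ entries $+1$ followed by $q$ entries $-1$. The $2^n$ elements $e$ and $e^{a_1\ldots a_k}=e^{a_1}\cdots e^{a_k}$ ($a_1<\dots<a_k$, $1\le k\le n$) form a basis. $\widehat{\mathbf k}=\mathcal{C}\!\ell^{\mathbb R}_k(p,q)$ is the real span of the basis elements with $k$ indices (rank $k$; $\widehat{\mathbf 0}=\mathbb R e$). For $k\in\{0,1,2,3\}$, $\overline{\mathbf k}=\bigoplus_{j\equiv k\,(\mathrm{mod}\,4),\,0\le j\le n}\widehat{\mathbf j}$, and $\overline{\mathbf{kl}}=\overline{\mathbf k}\oplus\overline{\mathbf l}$. *)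

theory Defs
  imports "HOL-Analysis.Analysis"
begin

section \<open>Real Clifford algebras\<close>

definition eta :: "nat \<Rightarrow> nat \<Rightarrow> nat \<Rightarrow> real" where
  "eta p a b = (if a = b then (if a \<le> p then 1 else -1) else 0)"

text \<open>\<open>blade e {a\<^sub>1 < \<dots> < a\<^sub>k} = e a\<^sub>1 * \<dots> * e a\<^sub>k\<close>, and \<open>blade e {} = 1\<close>.\<close>

definition blade :: "(nat \<Rightarrow> 'a::monoid_mult) \<Rightarrow> nat set \<Rightarrow> 'a" where
  "blade e A = prod_list (map e (sorted_list_of_set A))"

text \<open>
  \<open>C\<close> is the Clifford algebra of signature \<open>(p, q)\<close> on the generators \<open>e 1, \<dots>, e (p + q)\<close>, with
  the unit \<open>1\<close> of the ambient type as its identity. The algebra is a subset of the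
  type, not the whole type, so that one type contains the algebras of all signatures (see
  \<open>clifford_algebra_exists\<close> below). The injectivity condition makes the blades an independent
  \<^emph>\<open>family\<close>, so that the dimension of \<open>C\<close> is \<open>2 ^ (p + q)\<close>.
\<close>

definition clifford_algebra :: "nat \<Rightarrow> nat \<Rightarrow> (nat \<Rightarrow> 'a::real_algebra_1) \<Rightarrow> 'a set \<Rightarrow> bool" where
  "clifford_algebra p q e C \<longleftrightarrow>
     (\<forall>a\<in>{1..p+q}. \<forall>b\<in>{1..p+q}. e a * e b + e b * e a = (2 * eta p a b) *\<^sub>R 1) \<and>
     inj_on (blade e) (Pow {1..p+q}) \<and>
     independent (blade e ` Pow {1..p+q}) \<and>
     C = span (blade e ` Pow {1..p+q})"

definition rank_space :: "nat \<Rightarrow> (nat \<Rightarrow> 'a::real_algebra_1) \<Rightarrow> nat \<Rightarrow> 'a set" where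
  "rank_space n e k = span {blade e A | A. A \<subseteq> {1..n} \<and> card A = k}"

text \<open>
  Sums of subspaces are the pointwise sums of sets from \<open>HOL-Library.Set_Algebras\<close>. Sums over
  distinct ranks are direct by \<open>rank_spaces_independent\<close> below.
\<close>

definition quat_space :: "nat \<Rightarrow> (nat \<Rightarrow> 'a::real_algebra_1) \<Rightarrow> nat \<Rightarrow> 'a set" where
  "quat_space n e k = (\<Sum>j | j \<le> n \<and> j mod 4 = k mod 4. rank_space n e j)"

definition quat_space2 :: "nat \<Rightarrow> (nat \<Rightarrow> 'a::real_algebra_1) \<Rightarrow> nat \<Rightarrow> nat \<Rightarrow> 'a set" where
  "quat_space2 n e k l = quat_space n e k + quat_space n e l"

definition anticommutator :: "'a::ring \<Rightarrow> 'a \<Rightarrow> 'a" where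
  "anticommutator U V = U * V + V * U"

definition anticommutator_subalgebra :: "'a::real_algebra_1 set \<Rightarrow> 'a set \<Rightarrow> bool" where
  "anticommutator_subalgebra C S \<longleftrightarrow>
     subspace S \<and> S \<subseteq> C \<and> (\<forall>U\<in>S. \<forall>V\<in>S. anticommutator U V \<in> S)"


section \<open>Directness of the rank decomposition\<close>

lemma rank_spaces_independent:
  assumes C: "clifford_algebra p q e C"
    and J: "finite J"
    and x: "\<And>j. j \<in> J \<Longrightarrow> x j \<in> rank_space (p + q) e j"
    and sum0: "(\<Sum>j\<in>J. x j) = 0"
    and i: "i \<in> J"
  shows "x i = 0"
proof -
  let ?B = "blade e ` Pow {1..p+q}"
  let ?R = "\<lambda>k. {blade e A | A. A \<subseteq> {1..p+q} \<and> card A = k}"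
  have inj: "inj_on (blade e) (Pow {1..p+q})" and ind: "independent ?B"
    using C by (auto simp: clifford_algebra_def)
  have RB: "?R k \<subseteq> ?B" for k by auto
  have xs: "x j \<in> span (?R j)" if "j \<in> J" for j
    using x[OF that] by (simp add: rank_space_def)
  have xB: "x j \<in> span ?B" if "j \<in> J" for j
    using xs[OF that] span_mono[OF RB] by blast
  have mem: "b \<in> ?R j" if "j \<in> J" "representation ?B (x j) b \<noteq> 0" for j b
    using that representation_extend[OF ind xs[OF that(1)] RB]
    by (metis (no_types, lifting) representation_ne_zero)
  have disj: "j = k" if b: "b \<in> ?R j" "b \<in> ?R k" for j k b
  proof -
    obtain A D where "A \<subseteq> {1..p+q}" "card A = j" "b = blade e A"
      "D \<subseteq> {1..p+q}" "card D = k" "b = blade e D" using b by blast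
    with inj show ?thesis by (metis PowI inj_onD)
  qed
  have zero: "representation ?B (x i) b = 0" for b
  proof (rule ccontr)
    assume nz: "representation ?B (x i) b \<noteq> 0"
    have others: "representation ?B (x j) b = 0" if "j \<in> J - {i}" for j
      using that mem[OF i nz] mem[of j b] disj by blast
    have "representation ?B (\<Sum>j\<in>J. x j) b = (\<Sum>j\<in>J. representation ?B (x j) b)"
      using representation_sum[OF ind, of J x] xB by simp
    also have "\<dots> = representation ?B (x i) b"
      using others by (simp add: sum.remove[OF J i])
    finally show False
      using nz sum0 by (simp add: representation_zero)
  qed
  show ?thesis
    using sum_nonzero_representation_eq[OF ind xB[OF i]] zero by simp
qed


section \<open>Existence for every signature\<close>

text \<open>
  The generators act on real functions on \<^typ>\<open>nat set\<close> by a creation/annihilation representation.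
\<close>

typedef fock_op = "{F :: (nat set \<Rightarrow> real) \<Rightarrow> nat set \<Rightarrow> real.
    (\<forall>f g. F (\<lambda>A. f A + g A) = (\<lambda>A. F f A + F g A)) \<and>
    (\<forall>c f. F (\<lambda>A. c * f A) = (\<lambda>A. c * F f A))}"
  morphisms fock_apply fock_op
  by (rule exI[of _ "\<lambda>f. f"]) simp

setup_lifting type_definition_fock_op

instantiation fock_op :: real_algebra_1
begin

lift_definition zero_fock_op :: fock_op is "\<lambda>f A. 0" by simp
lift_definition one_fock_op :: fock_op is "\<lambda>f. f" by simp
lift_definition plus_fock_op :: "fock_op \<Rightarrow> fock_op \<Rightarrow> fock_op" is "\<lambda>F G f A. F f A + G f A"
  by (auto simp: algebra_simps)
lift_definition minus_fock_op :: "fock_op \<Rightarrow> fock_op \<Rightarrow> fock_op" is "\<lambda>F G f A. F f A - G f A"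
  by (auto simp: algebra_simps)
lift_definition uminus_fock_op :: "fock_op \<Rightarrow> fock_op" is "\<lambda>F f A. - F f A"
  by (auto simp: algebra_simps)
lift_definition times_fock_op :: "fock_op \<Rightarrow> fock_op \<Rightarrow> fock_op" is "\<lambda>F G f. F (G f)"
  by auto
lift_definition scaleR_fock_op :: "real \<Rightarrow> fock_op \<Rightarrow> fock_op" is "\<lambda>c F f A. c * F f A"
  by (auto simp: algebra_simps)

instance
proof
  show "(0::fock_op) \<noteq> 1"
    by transfer (metis zero_neq_one)
qed (transfer; auto simp: fun_eq_iff algebra_simps; fail)+

end

lemma fock_apply_sum:
  "fock_apply (\<Sum>i\<in>I. F i) f A = (\<Sum>i\<in>I. fock_apply (F i) f A)"
  by (induction I rule: infinite_finite_induct)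
    (simp_all add: zero_fock_op.rep_eq plus_fock_op.rep_eq)

definition flip :: "nat \<Rightarrow> nat set \<Rightarrow> nat set" where
  "flip a A = (if a \<in> A then A - {a} else insert a A)"

definition fock_sign :: "nat \<Rightarrow> nat \<Rightarrow> nat set \<Rightarrow> real" where
  "fock_sign p a A = (-1) ^ card {b\<in>A. b < a} * (if a \<in> A then eta p a a else 1)"

lift_definition fock_gen :: "nat \<Rightarrow> nat \<Rightarrow> fock_op" is
  "\<lambda>p a f A. fock_sign p a A * f (flip a A)"
  by (auto simp: algebra_simps)

lemma fock_sign_flip_same: "fock_sign p a A * fock_sign p a (flip a A) = eta p a a"
proof -
  have "{b \<in> flip a A. b < a} = {b\<in>A. b < a}" by (auto simp: flip_def)
  then show ?thesis
    by (auto simp: fock_sign_def flip_def eta_def simp flip: power_add mult_2)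
qed

lemma fock_sign_flip_greater: "a < b \<Longrightarrow> fock_sign p a (flip b A) = fock_sign p a A"
proof -
  assume "a < b"
  then have "{c \<in> flip b A. c < a} = {c\<in>A. c < a}" "a \<in> flip b A \<longleftrightarrow> a \<in> A"
    by (auto simp: flip_def)
  then show ?thesis by (simp add: fock_sign_def)
qed

lemma fock_sign_flip_less: "a < b \<Longrightarrow> fock_sign p b (flip a A) = - fock_sign p b A"
proof -
  assume ab: "a < b"
  have fin: "finite {c\<in>A. c < b}" by simp
  have mem: "b \<in> flip a A \<longleftrightarrow> b \<in> A" using ab by (auto simp: flip_def)
  show ?thesis
  proof (cases "a \<in> A")
    case True
    then have "{c\<in>A. c < b} = insert a {c \<in> flip a A. c < b}" "a \<notin> {c \<in> flip a A. c < b}"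
      using ab by (auto simp: flip_def)
    then have "card {c\<in>A. c < b} = Suc (card {c \<in> flip a A. c < b})" by simp
    then show ?thesis using mem by (simp add: fock_sign_def)
  next
    case False
    then have "{c \<in> flip a A. c < b} = insert a {c\<in>A. c < b}" "a \<notin> {c\<in>A. c < b}"
      using ab by (auto simp: flip_def)
    then have "card {c \<in> flip a A. c < b} = Suc (card {c\<in>A. c < b})" using fin by simp
    then show ?thesis using mem by (simp add: fock_sign_def)
  qed
qed

lemma flip_flip: "flip a (flip a A) = A"
  and flip_commute: "flip a (flip b A) = flip b (flip a A)"
  by (auto simp: flip_def)

lemma fock_gen_anticommute:
  "fock_gen p a * fock_gen p b + fock_gen p b * fock_gen p a = (2 * eta p a b) *\<^sub>R 1"
proof -
  have *: "fock_sign p a A * (fock_sign p b (flip a A) * f (flip b (flip a A))) +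
      fock_sign p b A * (fock_sign p a (flip b A) * f (flip a (flip b A))) = 2 * eta p a b * f A"
    for f A
  proof (cases a b rule: linorder_cases)
    case equal
    have "fock_sign p a A * (fock_sign p a (flip a A) * f A) = eta p a a * f A"
      by (metis fock_sign_flip_same mult.assoc)
    with equal show ?thesis by (simp add: flip_flip)
  next
    case less
    then show ?thesis
      by (simp add: fock_sign_flip_greater fock_sign_flip_less flip_commute[of b a] eta_def)
  next
    case greater
    then show ?thesis
      by (simp add: fock_sign_flip_greater fock_sign_flip_less flip_commute[of b a] eta_def)
  qed
  show ?thesis
    by (transfer fixing: p a b) (auto simp: fun_eq_iff *)
qed

lemma fock_blade:
  assumes "distinct xs"
  shows "\<exists>c. c \<noteq> 0 \<and> fock_apply (prod_list (map (fock_gen p) xs)) (\<lambda>A. if A = {} then 1 else 0)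
           = (\<lambda>A. if A = set xs then c else 0)"
  using assms
proof (induction xs)
  case Nil
  then show ?case by (auto simp: one_fock_op.rep_eq intro!: exI[of _ 1])
next
  case (Cons x xs)
  then obtain c where c: "c \<noteq> 0"
    "fock_apply (prod_list (map (fock_gen p) xs)) (\<lambda>A. if A = {} then 1 else 0)
      = (\<lambda>A. if A = set xs then c else 0)" by auto
  have x: "x \<notin> set xs" using Cons.prems by simp
  then have "flip x A = set xs \<longleftrightarrow> A = set (x # xs)" for A
    by (auto simp: flip_def)
  moreover have "fock_sign p x (set (x # xs)) \<noteq> 0"
    by (simp add: fock_sign_def eta_def)
  ultimately show ?case
    using c by (intro exI[of _ "fock_sign p x (set (x # xs)) * c"])
      (auto simp: times_fock_op.rep_eq fock_gen.rep_eq fun_eq_iff)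
qed

theorem clifford_algebra_exists:
  "\<exists>(e :: nat \<Rightarrow> fock_op) C. clifford_algebra p q e C"
proof -
  let ?P = "Pow {1..p+q}" and ?b = "blade (fock_gen p)"
  let ?v = "(\<lambda>A. if A = {} then 1 else 0) :: nat set \<Rightarrow> real"
  have "\<exists>c. c \<noteq> 0 \<and> fock_apply (?b A) ?v = (\<lambda>D. if D = A then c else 0)" if "A \<in> ?P" for A
    using that fock_blade[of "sorted_list_of_set A" p] finite_subset[of A "{1..p+q}"]
    by (simp add: blade_def)
  then obtain c where c: "\<And>A. A \<in> ?P \<Longrightarrow> c A \<noteq> 0"
    "\<And>A. A \<in> ?P \<Longrightarrow> fock_apply (?b A) ?v = (\<lambda>D. if D = A then c A else 0)"
    by metis
  have inj: "inj_on ?b ?P"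
    by (rule inj_onI) (metis c)
  have "independent (?b ` ?P)"
    unfolding independent_explicit_finite_subsets
  proof (intro allI impI ballI)
    fix T u b
    assume T: "T \<subseteq> ?b ` ?P" "finite T" and s: "(\<Sum>v\<in>T. u v *\<^sub>R v) = 0" and b: "b \<in> T"
    obtain A where A: "A \<in> ?P" "b = ?b A" using T b by blast
    have "fock_apply v ?v A = 0" if "v \<in> T - {b}" for v
    proof -
      obtain D where "D \<in> ?P" "v = ?b D" using T \<open>v \<in> T - {b}\<close> by blast
      moreover then have "D \<noteq> A" using A \<open>v \<in> T - {b}\<close> by blast
      ultimately show ?thesis using c(2) by auto
    qed
    then have "fock_apply (\<Sum>v\<in>T. u v *\<^sub>R v) ?v A = u b * c A"
      using A c(2)[OF A(1)]
      by (simp add: sum.remove[OF T(2) b] fock_apply_sum plus_fock_op.rep_eq scaleR_fock_op.rep_eq)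
    then show "u b = 0"
      using s c(1) A by (simp add: zero_fock_op.rep_eq)
  qed
  with inj show ?thesis
    using fock_gen_anticommute by (auto simp: clifford_algebra_def)
qed

end

theory Submission
  imports Defs
begin

text \<open>
  For blades \<open>e\<^sub>A\<close>, \<open>e\<^sub>B\<close> of ranks \<open>a\<close>, \<open>b\<close> whose index sets meet in \<open>i\<close> elements, \<open>e\<^sub>A e\<^sub>B\<close> is up to
  sign the blade of the symmetric difference, of rank \<open>a + b - 2i\<close>, and
  \<open>e\<^sub>A e\<^sub>B = (-1)\<^bsup>ab + i\<^esup> e\<^sub>B e\<^sub>A\<close>. So the anticommutator vanishes unless \<open>ab + i\<close> is even, and a sum of
  rank spaces is closed as soon as its set of ranks contains \<open>a + b - 2i\<close> in all those cases. This
  turns every item into arithmetic of ranks.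
\<close>

section \<open>Products of blades up to sign\<close>

locale clifford_generators =
  fixes p n :: nat and e :: "nat \<Rightarrow> 'a::real_algebra_1"
  assumes anticommute:
    "a \<in> {1..n} \<Longrightarrow> b \<in> {1..n} \<Longrightarrow> e a * e b + e b * e a = (2 * eta p a b) *\<^sub>R 1"
begin

lemma gen_swap:
  assumes "a \<in> {1..n}" "b \<in> {1..n}" "a \<noteq> b"
  shows "e a * e b = - (e b * e a)"
  using anticommute[OF assms(1,2)] assms(3) by (simp add: eta_def eq_neg_iff_add_eq_0)

lemma gen_square:
  assumes "a \<in> {1..n}"
  shows "e a * e a = 1 \<or> e a * e a = - 1"
proof -
  have "2 *\<^sub>R (e a * e a) = 2 *\<^sub>R (eta p a a *\<^sub>R 1)"
    using anticommute[OF assms assms] by (simp flip: scaleR_2)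
  then have "e a * e a = eta p a a *\<^sub>R 1"
    by (rule scaleR_left_imp_eq[rotated]) simp
  then show ?thesis by (auto simp: eta_def)
qed

text \<open>Passing a letter different from \<open>a\<close> changes the sign and passing
  \<open>a\<close> itself does not. Hence the exponent: one for every letter, and one more, which
  cancels it modulo 2, for the letter that coincides with \<open>a\<close>.\<close>

lemma gen_list_swap:
  assumes "a \<in> {1..n}" "set xs \<subseteq> {1..n}" "distinct xs"
  shows "e a * prod_list (map e xs) =
    (-1) ^ (length xs + card ({a} \<inter> set xs)) *\<^sub>R (prod_list (map e xs) * e a)"
  using assms(2,3)
proof (induction xs)
  case (Cons x xs)
  let ?P = "prod_list (map e xs)"
  have IH: "e a * ?P = (-1) ^ (length xs + card ({a} \<inter> set xs)) *\<^sub>R (?P * e a)"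
    using Cons by simp
  show ?case
  proof (cases "a = x")
    \<comment> \<open>Since \<open>a\<close> is the head and the list is distinct, the tail alone
      contributes \<open>length xs\<close> signs; the two extra units in the exponent, from the
      longer list and from the coincidence, cancel.\<close>
    case True
    with Cons.prems have "{a} \<inter> set xs = {}" by auto
    then have IH': "e x * ?P = (-1) ^ length xs *\<^sub>R (?P * e x)"
      using IH True by simp
    have "e x * (e x * ?P) = (-1) ^ length xs *\<^sub>R (e x * ?P * e x)"
      by (subst IH') (simp add: mult.assoc)
    with True Cons.prems show ?thesis by simp
  next
    case False
    have "e a * (e x * ?P) = - (e x * (e a * ?P))"
      using gen_swap[of a x] assms(1) Cons.prems False
      by (simp flip: mult.assoc)
    also have "\<dots> = (-1) ^ (length (x # xs) + card ({a} \<inter> set xs)) *\<^sub>R (e x * ?P * e a)"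
      by (simp add: IH mult.assoc)
    finally show ?thesis using False by simp
  qed
qed simp

text \<open>Each letter of \<open>xs\<close> is carried through the whole of \<open>ys\<close> by
  \<open>gen_list_swap\<close>. The exponents add up: the lengths give the product, and the
  coincidences give the size of the common index set.\<close>

lemma list_swap:
  assumes "set xs \<subseteq> {1..n}" "set ys \<subseteq> {1..n}" "distinct xs" "distinct ys"
  shows "prod_list (map e xs) * prod_list (map e ys) =
    (-1) ^ (length xs * length ys + card (set xs \<inter> set ys)) *\<^sub>R
      (prod_list (map e ys) * prod_list (map e xs))"
  using assms(1,3)
proof (induction xs)
  case (Cons x xs)
  let ?X = "prod_list (map e xs)" and ?Y = "prod_list (map e ys)"
  let ?i = "card (set xs \<inter> set ys)" and ?j = "card ({x} \<inter> set ys)"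
  \<comment> \<open>The head does not occur in \<open>xs\<close>, so this union is disjoint and the
    coincidences are counted once each.\<close>
  have "set (x # xs) \<inter> set ys = (set xs \<inter> set ys) \<union> ({x} \<inter> set ys)" by auto
  moreover have "card \<dots> = ?i + ?j"
    using Cons.prems by (intro card_Un_disjoint) auto
  ultimately have card: "card (set (x # xs) \<inter> set ys) = ?i + ?j" by simp
  have "e x * ?X * ?Y = (-1) ^ (length xs * length ys + ?i) *\<^sub>R (e x * ?Y * ?X)"
    using Cons by (simp add: mult.assoc)
  also have "e x * ?Y = (-1) ^ (length ys + ?j) *\<^sub>R (?Y * e x)"
    using Cons.prems assms by (intro gen_list_swap) auto
  finally have "e x * ?X * ?Y =
      (-1) ^ (length (x # xs) * length ys + (?i + ?j)) *\<^sub>R (?Y * (e x * ?X))"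
    by (simp add: mult.assoc power_add mult_ac)
  then show ?case using card by simp
qed simp

lemma blade_swap:
  assumes "A \<subseteq> {1..n}" "B \<subseteq> {1..n}"
  shows "blade e A * blade e B =
    (-1) ^ (card A * card B + card (A \<inter> B)) *\<^sub>R (blade e B * blade e A)"
proof -
  have "finite A" "finite B" using assms finite_subset by blast+
  then show ?thesis
    using list_swap[of "sorted_list_of_set A" "sorted_list_of_set B"] assms
    by (simp add: blade_def)
qed

lemma gen_mult_insort:
  assumes "a \<in> {1..n}" "set xs \<subseteq> {1..n}" "a \<notin> set xs"
  shows "e a * prod_list (map e xs) = prod_list (map e (insort a xs)) \<or>
    e a * prod_list (map e xs) = - prod_list (map e (insort a xs))"
  using assms(2,3)
proof (induction xs)
  case (Cons x xs)
  have "e a * (e x * prod_list (map e xs)) = - (e x * (e a * prod_list (map e xs)))"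
    using gen_swap[of a x] assms(1) Cons.prems by (simp flip: mult.assoc)
  with Cons show ?case by auto
qed simp

lemma gen_mult_blade_insert:
  assumes "a \<in> {1..n}" "A \<subseteq> {1..n}" "a \<notin> A"
  shows "e a * blade e A = blade e (insert a A) \<or> e a * blade e A = - blade e (insert a A)"
proof -
  have "finite A" using assms finite_subset by blast
  then show ?thesis
    using gen_mult_insort[of a "sorted_list_of_set A"] assms by (simp add: blade_def)
qed

text \<open>Left multiplication by a generator toggles its index: a missing index is inserted, and a
  present one is moved to the front, where the square of the generator is 1 or -1.\<close>

lemma gen_mult_blade:
  assumes "a \<in> {1..n}" "A \<subseteq> {1..n}"
  shows "e a * blade e A = blade e (flip a A) \<or> e a * blade e A = - blade e (flip a A)"
proof (cases "a \<in> A")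
  case True
  then have "e a * blade e (A - {a}) = blade e A \<or> e a * blade e (A - {a}) = - blade e A"
    using gen_mult_blade_insert[of a "A - {a}"] assms by (auto simp: insert_absorb)
  then have "e a * blade e A = (e a * e a) * blade e (A - {a}) \<or>
      e a * blade e A = - ((e a * e a) * blade e (A - {a}))"
    by (metis minus_mult_right minus_minus mult.assoc)
  then show ?thesis using gen_square[OF assms(1)] True by (auto simp: flip_def)
next
  case False
  then show ?thesis using gen_mult_blade_insert assms by (simp add: flip_def)
qed

text \<open>The letters are distinct, so each toggles its own index exactly once, and all the
  toggles together form the symmetric difference.\<close>

lemma list_mult_blade:
  assumes "set xs \<subseteq> {1..n}" "distinct xs" "B \<subseteq> {1..n}"
  shows "prod_list (map e xs) * blade e B = blade e (sym_diff (set xs) B) \<or>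
    prod_list (map e xs) * blade e B = - blade e (sym_diff (set xs) B)"
  using assms(1,2)
proof (induction xs)
  case (Cons x xs)
  let ?D = "sym_diff (set xs) B"
  have "flip x ?D = sym_diff (set (x # xs)) B"
    using Cons.prems by (auto simp: flip_def)
  moreover have "e x * blade e ?D = blade e (flip x ?D) \<or> e x * blade e ?D = - blade e (flip x ?D)"
    using Cons.prems assms(3) by (intro gen_mult_blade) auto
  ultimately show ?case using Cons by (auto simp: mult.assoc)
qed simp

lemma blade_mult_blade:
  assumes "A \<subseteq> {1..n}" "B \<subseteq> {1..n}"
  shows "blade e A * blade e B = blade e (sym_diff A B) \<or>
    blade e A * blade e B = - blade e (sym_diff A B)"
proof -
  have "finite A" using assms finite_subset by blast
  then show ?thesis
    using list_mult_blade[of "sorted_list_of_set A" B] assms by (simp add: blade_def)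
qed

end

section \<open>From closure of a span to arithmetic of ranks\<close>

lemma anticommutator_span:
  fixes S :: "'a::real_algebra_1 set"
  assumes "\<And>x y. x \<in> S \<Longrightarrow> y \<in> S \<Longrightarrow> anticommutator x y \<in> span S"
    and U: "U \<in> span S" and V: "V \<in> span S"
  shows "anticommutator U V \<in> span S"
proof -
  have add: "anticommutator (x + y) z = anticommutator x z + anticommutator y z"
    and scale: "anticommutator (c *\<^sub>R x) z = c *\<^sub>R anticommutator x z"
    and comm: "anticommutator x y = anticommutator y x"
    for x y z :: 'a and c
    by (simp_all add: anticommutator_def algebra_simps)
  have zero: "anticommutator 0 z = 0" for z :: 'a
    by (simp add: anticommutator_def)
  have left: "anticommutator W z \<in> span S"
    if "W \<in> span S" "\<And>x. x \<in> S \<Longrightarrow> anticommutator x z \<in> span S" for W z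
    using that(1)
    by (induction rule: span_induct_alt)
      (auto simp: add scale zero intro!: span_add span_scale span_zero that(2))
  \<comment> \<open>Linearity in the first argument gives the claim for \<open>V\<close> against
    elements of \<open>S\<close>; by symmetry these may be read as elements of \<open>S\<close>
    against \<open>V\<close>, and linearity applies once more, now for \<open>U\<close>.\<close>
  show ?thesis
    using left[OF U] left[OF V] assms(1) comm by metis
qed

text \<open>The span of a union is the sum of the spans. The empty sum is the set
  \<open>{0}\<close>, the neutral element of set addition and also the span of the empty
  set.\<close>

lemma sum_rank_space:
  assumes "finite J"
  shows "(\<Sum>j\<in>J. rank_space n e j) = span {blade e A | A. A \<subseteq> {1..n} \<and> card A \<in> J}"
  using assms
proof (induction J)
  case empty
  then show ?case by (simp flip: set_zero)
next
  case (insert j J)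
  have "{blade e A | A. A \<subseteq> {1..n} \<and> card A \<in> insert j J} =
      {blade e A | A. A \<subseteq> {1..n} \<and> card A = j} \<union> {blade e A | A. A \<subseteq> {1..n} \<and> card A \<in> J}"
    by auto
  then show ?case
    using insert by (auto simp: span_Un rank_space_def set_plus_def)
qed

text \<open>The bound \<open>a + b \<le> n + i\<close> says that the union of the two index sets fits into \<open>{1..n}\<close>.\<close>

definition closed_ranks :: "nat \<Rightarrow> nat set \<Rightarrow> bool" where
  "closed_ranks n J \<longleftrightarrow> finite J \<and>
     (\<forall>a\<in>J. \<forall>b\<in>J. \<forall>i. i \<le> a \<and> i \<le> b \<and> a + b \<le> n + i \<and> even (a * b + i) \<longrightarrow> a + b - 2 * i \<in> J)"

lemma card_sym_diff:
  assumes "finite A" "finite B"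
  shows "card (sym_diff A B) = card A + card B - 2 * card (A \<inter> B)"
proof -
  have "card (sym_diff A B) = card (A - B) + card (B - A)"
    using assms by (intro card_Un_disjoint) auto
  moreover have "card A = card (A - B) + card (A \<inter> B)" "card B = card (B - A) + card (A \<inter> B)"
    using assms card_Int_Diff[of A B] card_Int_Diff[of B A] by (simp_all add: Int_commute)
  ultimately show ?thesis by simp
qed

lemma closed_ranks_subalgebra:
  assumes C: "clifford_algebra p q e C" and n: "n = p + q" and J: "closed_ranks n J"
  shows "anticommutator_subalgebra C (\<Sum>j\<in>J. rank_space n e j)"
proof -
  interpret clifford_generators p n e
    using C n by unfold_locales (auto simp: clifford_algebra_def)
  let ?S = "{blade e A | A. A \<subseteq> {1..n} \<and> card A \<in> J}"
  have blades: "anticommutator (blade e A) (blade e B) \<in> span ?S"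
    if A: "A \<subseteq> {1..n}" "card A \<in> J" and B: "B \<subseteq> {1..n}" "card B \<in> J" for A B
  proof (cases "even (card A * card B + card (A \<inter> B))")
    case False
    with blade_swap[OF A(1) B(1)] show ?thesis
      by (simp add: anticommutator_def span_zero)
  next
    case True
    have fin: "finite A" "finite B" using A B finite_subset by blast+
    \<comment> \<open>Inclusion-exclusion inside \<open>{1..n}\<close> yields the size bound that
      \<open>closed_ranks\<close> demands for the intersection.\<close>
    have "card A + card B = card (A \<union> B) + card (A \<inter> B)"
      using fin by (rule card_Un_Int)
    moreover have "card (A \<union> B) \<le> n"
      using A B card_mono[of "{1..n}" "A \<union> B"] by simp
    ultimately have "card A + card B \<le> n + card (A \<inter> B)" by simp
    then have "card (sym_diff A B) \<in> J"
      using J A B True fin card_mono[of A "A \<inter> B"] card_mono[of B "A \<inter> B"]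
      by (simp add: closed_ranks_def card_sym_diff)
    then have "blade e (sym_diff A B) \<in> span ?S"
      using A B by (intro span_base) blast
    then have "blade e A * blade e B \<in> span ?S"
      using blade_mult_blade[OF A(1) B(1)] by (auto intro: span_neg)
    moreover have "blade e A * blade e B = blade e B * blade e A"
      using blade_swap[OF A(1) B(1)] True by simp
    ultimately show ?thesis
      by (auto simp: anticommutator_def intro: span_add)
  qed
  have "anticommutator U V \<in> span ?S" if "U \<in> span ?S" "V \<in> span ?S" for U V
    using _ that by (rule anticommutator_span) (use blades in blast)
  moreover have "span ?S \<subseteq> C"
  proof -
    have "?S \<subseteq> blade e ` Pow {1..n}" by auto
    moreover have "C = span (blade e ` Pow {1..n})"
      using C n by (simp add: clifford_algebra_def)
    ultimately show ?thesis by (simp only: span_mono)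
  qed
  ultimately show ?thesis
    using J by (simp add: anticommutator_subalgebra_def closed_ranks_def sum_rank_space)
qed

section \<open>Ranks in residue classes modulo 4\<close>

text \<open>Different residues give disjoint rank sets, so the two sums merge into a single sum over
  ranks, the form to which \<open>closed_ranks_subalgebra\<close> applies.\<close>

lemma quat_space2_eq_sum:
  assumes "k mod 4 \<noteq> l mod 4"
  shows "quat_space2 n e k l = (\<Sum>j | j \<le> n \<and> j mod 4 \<in> {k mod 4, l mod 4}. rank_space n e j)"
proof -
  have "{j. j \<le> n \<and> j mod 4 \<in> {k mod 4, l mod 4}} =
      {j. j \<le> n \<and> j mod 4 = k mod 4} \<union> {j. j \<le> n \<and> j mod 4 = l mod 4}" by auto
  then show ?thesis
    using assms unfolding quat_space2_def quat_space_def
    by (simp add: sum.union_disjoint disjoint_iff)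
qed

text \<open>A form suited to linear arithmetic: the new rank \<open>c\<close> is given by an
  equation instead of truncated subtraction, and the parity of \<open>a * b + i\<close> is expressed
  without the product.\<close>

lemma closed_ranksI:
  assumes "finite J"
    and "\<And>a b c i. a \<in> J \<Longrightarrow> b \<in> J \<Longrightarrow> i \<le> a \<Longrightarrow> i \<le> b \<Longrightarrow> a + b \<le> n + i \<Longrightarrow>
      c + 2 * i = a + b \<Longrightarrow> even i \<longleftrightarrow> even a \<or> even b \<Longrightarrow> c \<in> J"
  shows "closed_ranks n J"
  unfolding closed_ranks_def
proof (intro conjI ballI allI impI)
  fix a b i
  assume "a \<in> J" "b \<in> J" and i: "i \<le> a \<and> i \<le> b \<and> a + b \<le> n + i \<and> even (a * b + i)"
  moreover have "a + b - 2 * i + 2 * i = a + b" "even i \<longleftrightarrow> even a \<or> even b"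
    using i by auto
  ultimately show "a + b - 2 * i \<in> J"
    using assms(2) by blast
qed (rule assms(1))

text \<open>Modulo 4 the new rank is \<open>a + b - 2 * i\<close>, which depends on \<open>i\<close>
  only through its parity. Residues 0 and \<open>l\<close> give \<open>l\<close>; two residues
  \<open>l\<close> give \<open>2 * l\<close> for \<open>l = 2\<close> and \<open>2 * l - 2\<close>
  for odd \<open>l\<close>, which is 0 modulo 4 in each case.\<close>

lemma closed_ranks_mod4:
  assumes "M = {0} \<or> M = {0, l}" "l \<in> {1, 2, 3}"
  shows "closed_ranks n {j. j \<le> n \<and> j mod 4 \<in> M}"
proof (rule closed_ranksI)
  fix a b c i :: nat
  assume J: "a \<in> {j. j \<le> n \<and> j mod 4 \<in> M}" "b \<in> {j. j \<le> n \<and> j mod 4 \<in> M}"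
    and i: "i \<le> a" "i \<le> b" "a + b \<le> n + i"
    and c: "c + 2 * i = a + b" "even i \<longleftrightarrow> even a \<or> even b"
  have "(2 * i) mod 4 = 2 * (i mod 2)"
    using mult_mod_right[of 2 i 2] by simp
  then have sum: "(c + 2 * (i mod 2)) mod 4 = (a mod 4 + b mod 4) mod 4"
    using c(1) by (metis mod_add_eq mod_add_right_eq)
  \<comment> \<open>Stated through residues modulo 4, so that the final case analysis runs over the
    residues of \<open>a\<close> and \<open>b\<close> alone.\<close>
  have parity: "i mod 2 = (if a mod 4 \<in> {0, 2} \<or> b mod 4 \<in> {0, 2} then 0 else 1)"
  proof -
    have "even j \<longleftrightarrow> j mod 4 \<in> {0, 2}" for j :: nat
      by (simp; presburger)
    moreover have "i mod 2 = (if even a \<or> even b then 0 else 1)"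
      using c(2) by (simp add: mod2_eq_if)
    ultimately show ?thesis by (simp only:)
  qed
  \<comment> \<open>The case of two equal odd residues: both 1 + 1 and 3 + 3 are 2 modulo 4, and
    \<open>i\<close> is odd.\<close>
  have cases: "c mod 4 = 0" if "(c + 2) mod 4 = 2"
    using that by presburger
  have "M = {0} \<or> M = {0, 1} \<or> M = {0, 2} \<or> M = {0, 3}"
    using assms by auto
  then have "c mod 4 \<in> M"
    using J sum parity cases by auto
  with i c(1) show "c \<in> {j. j \<le> n \<and> j mod 4 \<in> M}" by simp
qed simp

section \<open>Ranks 0, 1, n - 1 and n\<close>

text \<open>An index set with at most one element meets any other in at most one index, and one that
  omits at most one index contains all but at most one index of any other. So at most two values of
  \<open>i\<close> remain, each with its \<open>c\<close>.\<close>

lemma extremal_ranks: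
  fixes a b c i n :: nat
  assumes "i \<le> a" "i \<le> b" "a + b \<le> n + i" "c + 2 * i = a + b"
    and "a = 0 \<or> a = 1 \<or> a + 1 = n \<or> a = n"
  shows "a = 0 \<and> i = 0 \<and> c = b \<or> a = 1 \<and> i = 0 \<and> c = b + 1 \<or> a = 1 \<and> i = 1 \<and> b = c + 1 \<or>
    a + 1 = n \<and> i = b \<and> c + b = a \<or> a + 1 = n \<and> i + 1 = b \<and> c + b = n + 1 \<or>
    a = n \<and> i = b \<and> c + b = n"
  using assms(5)
proof (elim disjE)
  assume "a = 0"
  with assms show ?thesis by simp
next
  assume a: "a = 1"
  with assms(1) have "i = 0 \<or> i = 1" by linarith
  with a assms(4) show ?thesis by auto
next
  assume a: "a + 1 = n"
  with assms(2,3) have "i = b \<or> i + 1 = b" by linarith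
  with a assms(4) show ?thesis by auto
next
  assume a: "a = n"
  with assms(2,3) have "i = b" by linarith
  with a assms(4) show ?thesis by auto
qed

text \<open>Parity selects among the values of \<open>i\<close> left by
  \<open>extremal_ranks\<close>. Blades of rank \<open>n\<close> anticommute with those of ranks 1
  and \<open>n - 1\<close> for even \<open>n\<close>; for odd \<open>n\<close> they commute, with
  products of ranks \<open>n - 1\<close> and 1. This decides which combinations are closed.\<close>

lemma closed_ranks_extremal:
  fixes n :: nat
  shows "n \<ge> 2 \<Longrightarrow> closed_ranks n {0, 1}"
    and "n \<ge> 2 \<Longrightarrow> closed_ranks n {0, n}"
    and "n \<ge> 3 \<Longrightarrow> closed_ranks n {0, n - 1}"
    and "n \<ge> 4 \<Longrightarrow> even n \<Longrightarrow> closed_ranks n {0, 1, n}"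
    and "n \<ge> 4 \<Longrightarrow> even n \<Longrightarrow> closed_ranks n {0, n - 1, n}"
    and "n \<ge> 5 \<Longrightarrow> odd n \<Longrightarrow> closed_ranks n {0, 1, n - 1, n}"
  \<comment> \<open>Writing \<open>n\<close> as a successor removes the truncated subtraction in
    \<open>n - 1\<close>.\<close>
  by (cases n, simp, rule closed_ranksI, simp, drule (3) extremal_ranks; auto)+

section \<open>Rank lists ending at k\<close>

lemma rank_set_eq:
  fixes k n :: nat
  assumes "k \<le> n" "\<And>j. k < j \<Longrightarrow> j \<le> n \<Longrightarrow> \<not> P j"
  shows "{j. j \<le> k \<and> P j} = {j. j \<le> n \<and> P j}"
  using assms by (auto simp: not_le[symmetric])

lemma rank_set_02:
  fixes k n :: nat
  assumes k: "even k" "n \<in> {k, k + 1}"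
  shows "{j. j \<le> k \<and> even j} = {j. j \<le> n \<and> j mod 4 \<in> {0, 2}}"
proof -
  have "even j \<longleftrightarrow> j mod 4 \<in> {0, 2}" for j :: nat
    by (simp; presburger)
  moreover have "{j. j \<le> k \<and> even j} = {j. j \<le> n \<and> even j}"
    using k by (intro rank_set_eq) (auto simp: le_Suc_eq)
  ultimately show ?thesis by simp
qed

text \<open>An even \<open>k\<close> is 0 modulo 4, and the next two ranks have residues 1 and 2. An
  odd \<open>k\<close> is 3 modulo 4, so \<open>k + 1\<close> would be admissible again; this is why
  \<open>n = k\<close> there.\<close>

lemma rank_set_03:
  fixes k n :: nat
  assumes k: "k mod 4 \<in> {0, 3}" "if even k then n \<in> {k, k + 1, k + 2} else n = k"
  shows "{j. j \<le> k \<and> j mod 4 \<in> {0, 3}} = {j. j \<le> n \<and> j mod 4 \<in> {0, 3}}"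
proof (rule rank_set_eq)
  fix j assume j: "k < j" "j \<le> n"
  with k(2) have "even k" "j = k + 1 \<or> j = k + 2" by (auto split: if_splits)
  moreover from this(1) k(1) have "k mod 4 = 0" by (simp; presburger)
  ultimately show "j mod 4 \<notin> {0, 3}" by (auto simp: mod_Suc)
qed (use k(2) in \<open>auto split: if_splits\<close>)

text \<open>The parities trade places: after \<open>k\<close> with residue 1 come residues 2 and 3,
  whereas after residue 0 the very next rank is admissible.\<close>

lemma rank_set_01:
  fixes k n :: nat
  assumes k: "k mod 4 \<in> {0, 1}" "if odd k then n \<in> {k, k + 1, k + 2} else n = k"
  shows "{j. j \<le> k \<and> j mod 4 \<in> {0, 1}} = {j. j \<le> n \<and> j mod 4 \<in> {0, 1}}"
proof (rule rank_set_eq)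
  fix j assume j: "k < j" "j \<le> n"
  with k(2) have "odd k" "j = k + 1 \<or> j = k + 2" by (auto split: if_splits)
  moreover from this(1) k(1) have "k mod 4 = 1" by (simp; presburger)
  ultimately show "j mod 4 \<notin> {0, 1}" by (auto simp: mod_Suc)
qed (use k(2) in \<open>auto split: if_splits\<close>)

lemma rank_set_0:
  fixes k n :: nat
  assumes k: "k mod 4 = 0" "n \<in> {k, k + 1, k + 2, k + 3}"
  shows "{j. j \<le> k \<and> j mod 4 = 0} = {j. j \<le> n \<and> j mod 4 = 0}"
proof (rule rank_set_eq)
  fix j assume j: "k < j" "j \<le> n"
  with k(2) have "j = k + 1 \<or> j = k + 2 \<or> j = k + 3" by auto
  with k(1) show "j mod 4 \<noteq> 0" by presburger
qed (use k(2) in auto)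

section \<open>Rank sets in low dimensions\<close>

lemma small_rank_sets_02:
  "{j. j \<le> (1::nat) \<and> j mod 4 \<in> {0, 2}} = {0}"
  "{j. j \<le> (2::nat) \<and> j mod 4 \<in> {0, 2}} = {0, 2}"
  "{j. j \<le> (3::nat) \<and> j mod 4 \<in> {0, 2}} = {0, 2}"
  by (rule set_eqI, simp, presburger)+

lemma small_rank_sets_03:
  "{j. j \<le> (1::nat) \<and> j mod 4 \<in> {0, 3}} = {0}"
  "{j. j \<le> (2::nat) \<and> j mod 4 \<in> {0, 3}} = {0}"
  "{j. j \<le> (3::nat) \<and> j mod 4 \<in> {0, 3}} = {0, 3}"
  "{j. j \<le> (4::nat) \<and> j mod 4 \<in> {0, 3}} = {0, 3, 4}"
  by (rule set_eqI, simp, presburger)+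

lemma small_rank_sets_01:
  "{j. j \<le> (2::nat) \<and> j mod 4 \<in> {0, 1}} = {0, 1}"
  "{j. j \<le> (3::nat) \<and> j mod 4 \<in> {0, 1}} = {0, 1}"
  "{j. j \<le> (4::nat) \<and> j mod 4 \<in> {0, 1}} = {0, 1, 4}"
  "{j. j \<le> (5::nat) \<and> j mod 4 \<in> {0, 1}} = {0, 1, 4, 5}"
  by (rule set_eqI, simp, presburger)+

lemma small_rank_sets_0:
  "{j. j \<le> (1::nat) \<and> j mod 4 = 0} = {0}"
  "{j. j \<le> (2::nat) \<and> j mod 4 = 0} = {0}"
  "{j. j \<le> (3::nat) \<and> j mod 4 = 0} = {0}"
  "{j. j \<le> (4::nat) \<and> j mod 4 = 0} = {0, 4}"
  "{j. j \<le> (5::nat) \<and> j mod 4 = 0} = {0, 4}"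
  by (rule set_eqI, simp, presburger)+

section \<open>The eleven families of anticommutator subalgebras\<close>

theorem theorem11:
  fixes p q n :: nat
    and e :: "nat \<Rightarrow> 'a::real_algebra_1"
    and C :: "'a set"
    and R :: "nat \<Rightarrow> 'a set"
  assumes C: "clifford_algebra p q e C"
    and n: "n = p + q" "n \<ge> 1"
    and R: "R = rank_space n e"
  shows
    "(n \<ge> 1 \<longrightarrow> anticommutator_subalgebra C (R 0)) \<and>
     (n \<ge> 2 \<longrightarrow> anticommutator_subalgebra C (R 0 + R 1)) \<and>
     (n \<ge> 2 \<longrightarrow> anticommutator_subalgebra C (R 0 + R n)) \<and>
     (n \<ge> 3 \<longrightarrow> anticommutator_subalgebra C (R 0 + R (n - 1))) \<and>
     (even n \<and> n \<ge> 4 \<longrightarrow> anticommutator_subalgebra C (R 0 + R 1 + R n)) \<and>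
     (even n \<and> n \<ge> 4 \<longrightarrow> anticommutator_subalgebra C (R 0 + R (n - 1) + R n)) \<and>

     (n \<ge> 4 \<longrightarrow> anticommutator_subalgebra C (quat_space2 n e 0 2) \<and>
        (\<forall>k. even k \<and> n \<in> {k, k + 1} \<longrightarrow>
           (\<Sum>j | j \<le> k \<and> even j. R j) = quat_space2 n e 0 2)) \<and>
     (n = 1 \<longrightarrow> quat_space2 n e 0 2 = R 0) \<and>
     (n = 2 \<longrightarrow> quat_space2 n e 0 2 = R 0 + R n) \<and>
     (n = 3 \<longrightarrow> quat_space2 n e 0 2 = R 0 + R (n - 1)) \<and>

     (odd n \<and> n \<ge> 5 \<longrightarrow> anticommutator_subalgebra C (R 0 + R 1 + R (n - 1) + R n)) \<and>

     (n \<ge> 5 \<longrightarrow> anticommutator_subalgebra C (quat_space2 n e 0 3) \<and>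
        (\<forall>k. k mod 4 \<in> {0, 3} \<and> (if even k then n \<in> {k, k + 1, k + 2} else n = k) \<longrightarrow>
           (\<Sum>j | j \<le> k \<and> j mod 4 \<in> {0, 3}. R j) = quat_space2 n e 0 3)) \<and>
     (n \<in> {1, 2} \<longrightarrow> quat_space2 n e 0 3 = R 0) \<and>
     (n = 3 \<longrightarrow> quat_space2 n e 0 3 = R 0 + R n) \<and>
     (n = 4 \<longrightarrow> quat_space2 n e 0 3 = R 0 + R (n - 1) + R n) \<and>

     (n \<ge> 6 \<longrightarrow> anticommutator_subalgebra C (quat_space2 n e 0 1) \<and>
        (\<forall>k. k mod 4 \<in> {0, 1} \<and> (if odd k then n \<in> {k, k + 1, k + 2} else n = k) \<longrightarrow>
           (\<Sum>j | j \<le> k \<and> j mod 4 \<in> {0, 1}. R j) = quat_space2 n e 0 1)) \<and>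
     (n \<in> {2, 3} \<longrightarrow> quat_space2 n e 0 1 = R 0 + R 1) \<and>
     (n = 4 \<longrightarrow> quat_space2 n e 0 1 = R 0 + R 1 + R n) \<and>
     (n = 5 \<longrightarrow> quat_space2 n e 0 1 = R 0 + R 1 + R (n - 1) + R n) \<and>

     (n \<ge> 6 \<longrightarrow> anticommutator_subalgebra C (quat_space n e 0) \<and>
        (\<forall>k. k mod 4 = 0 \<and> n \<in> {k, k + 1, k + 2, k + 3} \<longrightarrow>
           (\<Sum>j | j \<le> k \<and> j mod 4 = 0. R j) = quat_space n e 0)) \<and>
     (n \<in> {1, 2, 3} \<longrightarrow> quat_space n e 0 = R 0) \<and>
     (n = 4 \<longrightarrow> quat_space n e 0 = R 0 + R n) \<and>
     (n = 5 \<longrightarrow> quat_space n e 0 = R 0 + R (n - 1))"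
proof -
  have sub: "anticommutator_subalgebra C (\<Sum>j\<in>J. R j)" if "closed_ranks n J" for J
    using closed_ranks_subalgebra[OF C n(1) that] R by simp
  have Q: "quat_space2 n e 0 2 = (\<Sum>j | j \<le> n \<and> j mod 4 \<in> {0, 2}. R j)"
    "quat_space2 n e 0 3 = (\<Sum>j | j \<le> n \<and> j mod 4 \<in> {0, 3}. R j)"
    "quat_space2 n e 0 1 = (\<Sum>j | j \<le> n \<and> j mod 4 \<in> {0, 1}. R j)"
    "quat_space n e 0 = (\<Sum>j | j \<le> n \<and> j mod 4 = 0. R j)"
    using quat_space2_eq_sum[of 0 _ n e] R by (simp_all add: quat_space_def)

  \<comment> \<open>For the residue set \<open>{0}\<close> the second residue \<open>l\<close> is a
    free choice among 1, 2, 3; it is taken to be 1.\<close>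
  have quat_sub: "anticommutator_subalgebra C (quat_space2 n e 0 2)"
    "anticommutator_subalgebra C (quat_space2 n e 0 3)"
    "anticommutator_subalgebra C (quat_space2 n e 0 1)"
    "anticommutator_subalgebra C (quat_space n e 0)"
    using closed_ranks_mod4[of "{0, 2}" 2 n] closed_ranks_mod4[of "{0, 3}" 3 n]
      closed_ranks_mod4[of "{0, 1}" 1 n] closed_ranks_mod4[of "{0}" 1 n]
    unfolding Q by (simp_all add: sub)

  have item1: "anticommutator_subalgebra C (R 0)"
  proof -
    have "closed_ranks n {0}" by (rule closed_ranksI) simp_all
    then show ?thesis using sub[of "{0}"] by simp
  qed
  \<comment> \<open>Here and in the items below, the lower bound on \<open>n\<close> keeps the
    listed ranks distinct, so that the sum over the rank set expands to the written sum of
    spaces.\<close>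
  have item2: "anticommutator_subalgebra C (R 0 + R 1)" if "n \<ge> 2"
    using sub[OF closed_ranks_extremal(1)] that by simp
  have item3: "anticommutator_subalgebra C (R 0 + R n)" if "n \<ge> 2"
    using sub[OF closed_ranks_extremal(2)] that by simp
  have item4: "anticommutator_subalgebra C (R 0 + R (n - 1))" if "n \<ge> 3"
    using sub[OF closed_ranks_extremal(3)] that by simp
  have item5: "anticommutator_subalgebra C (R 0 + R 1 + R n)" if "n \<ge> 4" "even n"
    using sub[OF closed_ranks_extremal(4)] that by (simp add: add.assoc)
  have item6: "anticommutator_subalgebra C (R 0 + R (n - 1) + R n)" if "n \<ge> 4" "even n"
    using sub[OF closed_ranks_extremal(5)] that by (simp add: add.assoc)
  have item8: "anticommutator_subalgebra C (R 0 + R 1 + R (n - 1) + R n)" if "n \<ge> 5" "odd n"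
    using sub[OF closed_ranks_extremal(6)] that by (simp add: add.assoc)

  have truncated: "\<forall>k. even k \<and> n \<in> {k, k + 1} \<longrightarrow>
      (\<Sum>j | j \<le> k \<and> even j. R j) = quat_space2 n e 0 2"
    "\<forall>k. k mod 4 \<in> {0, 3} \<and> (if even k then n \<in> {k, k + 1, k + 2} else n = k) \<longrightarrow>
      (\<Sum>j | j \<le> k \<and> j mod 4 \<in> {0, 3}. R j) = quat_space2 n e 0 3"
    "\<forall>k. k mod 4 \<in> {0, 1} \<and> (if odd k then n \<in> {k, k + 1, k + 2} else n = k) \<longrightarrow>
      (\<Sum>j | j \<le> k \<and> j mod 4 \<in> {0, 1}. R j) = quat_space2 n e 0 1"
    "\<forall>k. k mod 4 = 0 \<and> n \<in> {k, k + 1, k + 2, k + 3} \<longrightarrow>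
      (\<Sum>j | j \<le> k \<and> j mod 4 = 0. R j) = quat_space n e 0"
    unfolding Q
    by (intro allI impI sum.cong refl rank_set_02 rank_set_03 rank_set_01 rank_set_0;
        elim conjE; assumption)+

  \<comment> \<open>For a fixed small \<open>n\<close> the rank set is an explicit list, and the
    coincidences with earlier items are read off from it.\<close>
  have small_02: "n = 1 \<Longrightarrow> quat_space2 n e 0 2 = R 0"
    "n = 2 \<Longrightarrow> quat_space2 n e 0 2 = R 0 + R n"
    "n = 3 \<Longrightarrow> quat_space2 n e 0 2 = R 0 + R (n - 1)"
    unfolding Q by (simp only: small_rank_sets_02; simp)+
  have small_03: "n \<in> {1, 2} \<Longrightarrow> quat_space2 n e 0 3 = R 0"
    "n = 3 \<Longrightarrow> quat_space2 n e 0 3 = R 0 + R n"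
    "n = 4 \<Longrightarrow> quat_space2 n e 0 3 = R 0 + R (n - 1) + R n"
    unfolding Q
    by ((elim insertE emptyE)?; simp only: small_rank_sets_03; simp add: add.assoc)+
  have small_01: "n \<in> {2, 3} \<Longrightarrow> quat_space2 n e 0 1 = R 0 + R 1"
    "n = 4 \<Longrightarrow> quat_space2 n e 0 1 = R 0 + R 1 + R n"
    "n = 5 \<Longrightarrow> quat_space2 n e 0 1 = R 0 + R 1 + R (n - 1) + R n"
    unfolding Q
    by ((elim insertE emptyE)?; simp only: small_rank_sets_01; simp add: add.assoc)+
  have small_0: "n \<in> {1, 2, 3} \<Longrightarrow> quat_space n e 0 = R 0"
    "n = 4 \<Longrightarrow> quat_space n e 0 = R 0 + R n"
    "n = 5 \<Longrightarrow> quat_space n e 0 = R 0 + R (n - 1)"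
    unfolding Q
    by ((elim insertE emptyE)?; simp only: small_rank_sets_0; simp)+

  show ?thesis
    by (intro conjI impI; (elim conjE)?;
        rule item1 item2 item3 item4 item5 item6 item8 quat_sub truncated
          small_02 small_03 small_01 small_0; assumption)
qed

end
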